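(* Let $d\ge 2$ be an integer, let $G$ be a graph (loops and multiple edges allowed), write $G^{[d-1]}=(V,E,L)$, and let $q:L\to\mathbb{R}^d$ be such that $\dim W_v\ge d-1$ for all $v\in V$, where $W_v$ is the linear span of $\{q(e): e\in L \text{ a loop at } v\}$. Then $(G^{[d-1]},p,q)$ is infinitesimally rigid for some $p:V\to\mathbb{R}^d$ if and only if every connected component of $G$ has a cycle $C$ of length not equal to two such that $q$ is line-admissible on $C^{[d-1]}$.
   Context: A graph $G=(V,E,L)$ is finite and may contain multiple edges and loops; $V$, $E$, $L$ are its sets of vertices, (non-loop) edges and loops. $G^{[k]}$ denotes the graph obtained from $G$ by adding $k$ (new) loops at each vertex of $G$; the loops already present in $G$ are also loops of $G^{[k]}$. A cycle of length $k$ is a connected graph with $k$ edges (here loops count as edges) in which each vertex has degree two, where a loop contributes two to the degree of its vertex. Thus a cycle of length one is a single vertex with one loop, and a cycle of length two is a pair of parallel edges. For a graph $H=(V_H,E_H,L_H)$ and a map $q:L_H\to\mathbb{R}^d$, $q$ is line-admissible on $H$ if, for each $v\in V_H$, the linear span of $\{q(e): e\in L_H \text{ a loop at } v\}$ has dimension at least $d-1$, and the linear span of $q(L_H)$ has dimension $d$. For a cycle $C$ in $G$, $C^{[d-1]}$ is regarded as a subgraph of $G^{[d-1]}$: it consists of $C$ together with $d-1$ further loops of $G^{[d-1]}$ at each vertex of $C$ (so if $C$ is a loop at $v$, then $C^{[d-1]}$ consists of $v$ with $d$ loops). The loops of $G^{[d-1]}$ at a vertex are not distinguished from each other, so "$q$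 is line-admissible on $C^{[d-1]}$" means that the restriction of $q$ is line-admissible on some such subgraph. A linearly-constrained framework in $\mathbb{R}^d$ is a triple $(G,p,q)$ where $G=(V,E,L)$ is a graph, $p:V\to\mathbb{R}^d$ and $q:L\to\mathbb{R}^d$. An infinitesimal motion of $(G,p,q)$ is a map $\dot p:V\to\mathbb{R}^d$ such that $(p(u)-p(v))\cdot(\dot p(u)-\dot p(v))=0$ for every edge $uv\in E$, and $q(e)\cdot\dot p(v)=0$ for every loop $e\in L$ incident to the vertex $v$. The framework is infinitesimally rigid if its only infinitesimal motion is $\dot p=0$. *)

theory Defs
  imports "HOL-Analysis.Analysis"
begin

text \<open>Finite undirected graphs with multiple edges and loops. Non-loop edges and loops are two
  separate sorts; a non-loop edge has a set of two ends, a loop has a single vertex.\<close>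

record ('v, 'e, 'l) mgraph =
  verts :: "'v set"
  edges :: "'e set"
  loops :: "'l set"
  ends :: "'e \<Rightarrow> 'v set"
  base :: "'l \<Rightarrow> 'v"

definition is_graph :: "('v, 'e, 'l) mgraph \<Rightarrow> bool" where
  "is_graph G \<longleftrightarrow>
     finite (verts G) \<and> finite (edges G) \<and> finite (loops G) \<and>
     (\<forall>e \<in> edges G. ends G e \<subseteq> verts G \<and> card (ends G e) = 2) \<and>
     (\<forall>l \<in> loops G. base G l \<in> verts G)"

definition loops_at :: "('v, 'e, 'l) mgraph \<Rightarrow> 'v \<Rightarrow> 'l set" where
  "loops_at G v = {l \<in> loops G. base G l = v}"

definition degree :: "('v, 'e, 'l) mgraph \<Rightarrow> 'v \<Rightarrow> nat" where
  "degree G v = card {e \<in> edges G. v \<in> ends G e} + 2 * card (loops_at G v)"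

text \<open>The incidence functions of a subgraph only need to agree with those of the ambient graph on
  the edges and loops of the subgraph.\<close>

definition subgraph :: "('v, 'e, 'l) mgraph \<Rightarrow> ('v, 'e, 'l) mgraph \<Rightarrow> bool" where
  "subgraph H G \<longleftrightarrow>
     is_graph H \<and> verts H \<subseteq> verts G \<and> edges H \<subseteq> edges G \<and> loops H \<subseteq> loops G \<and>
     (\<forall>e \<in> edges H. ends H e = ends G e) \<and>
     (\<forall>l \<in> loops H. base H l = base G l)"

definition connected_graph :: "('v, 'e, 'l) mgraph \<Rightarrow> bool" where
  "connected_graph G \<longleftrightarrow>
     is_graph G \<and> verts G \<noteq> {} \<and>
     (\<forall>u \<in> verts G. \<forall>v \<in> verts G. (u, v) \<in> {(x, y). \<exists>e \<in> edges G. ends G e = {x, y}}\<^sup>*)"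

text \<open>Maximality is expressed by mutual \<open>subgraph\<close> rather than by equality of records, since the
  incidence functions are arbitrary outside the graph.\<close>

definition connected_component_of_graph ::
    "('v, 'e, 'l) mgraph \<Rightarrow> ('v, 'e, 'l) mgraph \<Rightarrow> bool" where
  "connected_component_of_graph H G \<longleftrightarrow>
     subgraph H G \<and> connected_graph H \<and>
     (\<forall>H'. subgraph H' G \<and> connected_graph H' \<and> subgraph H H' \<longrightarrow> subgraph H' H)"

definition is_cycle :: "nat \<Rightarrow> ('v, 'e, 'l) mgraph \<Rightarrow> bool" where
  "is_cycle k C \<longleftrightarrow>
     connected_graph C \<and> card (edges C) + card (loops C) = k \<and>
     (\<forall>v \<in> verts C. degree C v = 2)"

text \<open>\<open>add_loops k G\<close> is \<open>G\<close> with \<open>k\<close> new loops at each vertex; the loops of \<open>G\<close> are the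
  loops \<open>Inl l\<close>, the new loops at \<open>v\<close> are \<open>Inr (v, i)\<close> for \<open>i < k\<close>.\<close>

definition add_loops :: "nat \<Rightarrow> ('v, 'e, 'l) mgraph \<Rightarrow> ('v, 'e, 'l + 'v \<times> nat) mgraph" where
  "add_loops k G =
     \<lparr>verts = verts G, edges = edges G,
      loops = Inl ` loops G \<union> Inr ` (verts G \<times> {..<k}),
      ends = ends G, base = case_sum (base G) fst\<rparr>"

text \<open>\<open>K\<close> is one of the copies of \<open>add_loops k C\<close> inside \<open>add_loops k G\<close>, for a subgraph \<open>C\<close>
  of \<open>G\<close>: it consists of \<open>C\<close> and, at each vertex of \<open>C\<close>, any \<open>k\<close> further loops of
  \<open>add_loops k G\<close>. The further loops may be new loops or loops of \<open>G\<close> not in \<open>C\<close>.\<close>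

definition add_loops_copy ::
    "nat \<Rightarrow> ('v, 'e, 'l) mgraph \<Rightarrow> ('v, 'e, 'l) mgraph \<Rightarrow> ('v, 'e, 'l + 'v \<times> nat) mgraph \<Rightarrow> bool"
where
  "add_loops_copy k G C K \<longleftrightarrow>
     subgraph K (add_loops k G) \<and> verts K = verts C \<and> edges K = edges C \<and>
     Inl ` loops C \<subseteq> loops K \<and>
     (\<forall>v \<in> verts C. card (loops_at K v - Inl ` loops C) = k)"

definition loop_span :: "('v, 'e, 'l) mgraph \<Rightarrow> ('l \<Rightarrow> real ^ 'd) \<Rightarrow> 'v \<Rightarrow> (real ^ 'd) set" where
  "loop_span H q v = span (q ` loops_at H v)"

definition line_admissible :: "('v, 'e, 'l) mgraph \<Rightarrow> ('l \<Rightarrow> real ^ 'd) \<Rightarrow> bool" where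
  "line_admissible H q \<longleftrightarrow>
     (\<forall>v \<in> verts H. dim (loop_span H q v) \<ge> CARD('d) - 1) \<and>
     dim (span (q ` loops H)) = CARD('d)"

definition infinitesimal_motion ::
    "('v, 'e, 'l) mgraph \<Rightarrow> ('v \<Rightarrow> real ^ 'd) \<Rightarrow> ('l \<Rightarrow> real ^ 'd) \<Rightarrow> ('v \<Rightarrow> real ^ 'd) \<Rightarrow> bool"
where
  "infinitesimal_motion G p q m \<longleftrightarrow>
     (\<forall>e \<in> edges G. \<forall>u v. ends G e = {u, v} \<longrightarrow> (p u - p v) \<bullet> (m u - m v) = 0) \<and>
     (\<forall>l \<in> loops G. q l \<bullet> m (base G l) = 0)"

text \<open>Placements and motions are total functions, of which only the values on \<open>verts G\<close> matter.\<close>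

definition infinitesimally_rigid ::
    "('v, 'e, 'l) mgraph \<Rightarrow> ('v \<Rightarrow> real ^ 'd) \<Rightarrow> ('l \<Rightarrow> real ^ 'd) \<Rightarrow> bool" where
  "infinitesimally_rigid G p q \<longleftrightarrow>
     (\<forall>m. infinitesimal_motion G p q m \<longrightarrow> (\<forall>v \<in> verts G. m v = 0))"

end

theory Submission imports Defs begin

text \<open>The loops at a vertex \<open>v\<close> confine its velocity to the orthogonal complement of \<open>W\<^sub>v\<close>, the span
  of their vectors. Since \<open>W\<^sub>v\<close> is the whole space or a hyperplane, the velocity is zero in the first
  case and \<open>t\<^sub>v n\<^sub>v\<close> with a scalar \<open>t\<^sub>v\<close> and a normal \<open>n\<^sub>v\<close> in the second. So there is at most one
  unknown per vertex, and adjacent vertices \<open>u\<close>, \<open>v\<close> impose the single linear equation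
  \<open>t\<^sub>u (p\<^sub>u - p\<^sub>v) \<bullet> n\<^sub>u = t\<^sub>v (p\<^sub>u - p\<^sub>v) \<bullet> n\<^sub>v\<close>; parallel edges repeat it, which is why
  cycles of length two are useless. Motions, and admissible cycles, can be treated in each connected
  component separately (\<open>rigid_iff_components_rigid\<close>, \<open>all_components_iff\<close>).

  A cycle suffices (\<open>rigid_if_admissible_cycle\<close>). For generic \<open>p\<close> all the coefficients above are
  nonzero, so a motion of a component that vanishes at one vertex vanishes on all of it. This settles
  components with a vertex where \<open>W\<^sub>v\<close> is the whole space. Otherwise line-admissibility forces an
  edge \<open>a b\<close> of the cycle with \<open>W\<^sub>a \<noteq> W\<^sub>b\<close>. Choosing \<open>p\<^sub>b - p\<^sub>a\<close> in \<open>W\<^sub>a\<close> but not in \<open>W\<^sub>b\<close>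
  kills the coefficient of \<open>t\<^sub>a\<close> and not that of \<open>t\<^sub>b\<close>, so \<open>t\<^sub>b = 0\<close>. The zero spreads from \<open>b\<close>
  along every other adjacency, and reaches \<open>a\<close> around the rest of the cycle (\<open>cycle_detour\<close>).

  A cycle is necessary (\<open>admissible_cycle_if_rigid\<close>). If \<open>W\<^sub>v\<close> is the whole space, some loop of \<open>G\<close>
  at \<open>v\<close> is part of a basis and gives a cycle of length one. If all the spaces are hyperplanes,
  suppose that each adjacent pair with different hyperplanes is a bridge of the underlying simple
  graph. Cutting at a bridge leaves two parts with nonzero motions, and the one equation of the bridge
  can be met by rescaling them against each other; where nothing is left to cut, all normals of
  adjacent vertices agree and the constant \<open>t = 1\<close> is a motion (\<open>flex_along_normals\<close>). So in a rigid
  component some such pair is not a bridge, hence lies on a cycle of length at least three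
  (\<open>cycle_through_non_bridge\<close>), and two different hyperplanes together span the space.\<close>

section \<open>Normals of hyperplanes\<close>

lemma normal_exists:
  fixes W :: "'a::euclidean_space set"
  assumes sub: "subspace W" and dimW: "dim W \<ge> DIM('a) - 1"
  shows "\<exists>n. n \<noteq> 0 \<and> (\<forall>m. (\<forall>w\<in>W. w \<bullet> m = 0) \<longrightarrow> (\<exists>t. m = t *\<^sub>R n)) \<and>
             (W \<noteq> UNIV \<longrightarrow> W = {x. n \<bullet> x = 0})"
proof (cases "W = UNIV")
  case True
  obtain b :: 'a where "b \<in> Basis" using nonempty_Basis by blast
  then have b: "b \<noteq> 0" by auto
  have "m = 0" if "\<forall>w\<in>W. w \<bullet> m = 0" for m
    using that True by (metis UNIV_I inner_eq_zero_iff)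
  then show ?thesis using True b by (metis scaleR_zero_left)
next
  case False
  have "dim W \<noteq> DIM('a)"
    using False sub dim_eq_full by (metis span_eq_iff)
  then have "dim W < DIM('a)" using dim_subset_UNIV[of W] by simp
  then obtain n where n: "n \<noteq> 0" "span W \<subseteq> {x. n \<bullet> x = 0}"
    using lowdim_subset_hyperplane by blast
  have W: "W = {x. n \<bullet> x = 0}"
  proof (rule subspace_dim_equal)
    show "W \<subseteq> {x. n \<bullet> x = 0}" using n span_superset by blast
  qed (use sub n dimW in \<open>auto simp: subspace_hyperplane dim_hyperplane\<close>)
  have "\<exists>t. m = t *\<^sub>R n" if m: "\<forall>w\<in>W. w \<bullet> m = 0" for m
  proof -
    define r where "r = m - ((m \<bullet> n) / (n \<bullet> n)) *\<^sub>R n"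
    have rn: "n \<bullet> r = 0" using n by (simp add: r_def inner_diff_right inner_commute)
    then have "r \<bullet> m = 0" using m W by blast
    then have "r \<bullet> r = 0"
      using rn by (subst (2) r_def) (simp add: inner_diff_right inner_commute)
    then show ?thesis unfolding r_def by auto
  qed
  then show ?thesis using n W by blast
qed

text \<open>For the whole space every vector orthogonal to it is zero; \<open>normal\<close> is then an arbitrary
  nonzero vector, which lets genericity conditions be stated uniformly for all vertices.\<close>

definition normal :: "'a::euclidean_space set \<Rightarrow> 'a" where
  "normal W = (SOME n. n \<noteq> 0 \<and> (\<forall>m. (\<forall>w\<in>W. w \<bullet> m = 0) \<longrightarrow> (\<exists>t. m = t *\<^sub>R n)) \<and>
                      (W \<noteq> UNIV \<longrightarrow> W = {x. n \<bullet> x = 0}))"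

lemma normal:
  fixes W :: "'a::euclidean_space set"
  assumes "subspace W" and "dim W \<ge> DIM('a) - 1"
  shows normal_nonzero: "normal W \<noteq> 0"
    and orthogonal_imp_multiple_of_normal:
      "(\<And>w. w \<in> W \<Longrightarrow> w \<bullet> m = 0) \<Longrightarrow> \<exists>t. m = t *\<^sub>R normal W"
    and hyperplane_eq_normal: "W \<noteq> UNIV \<Longrightarrow> W = {x. normal W \<bullet> x = 0}"
  using someI_ex[OF normal_exists[OF assms]] unfolding normal_def[symmetric] by blast+

lemma dim_hyperplane_space:
  fixes W :: "'a::euclidean_space set"
  assumes "subspace W" "dim W \<ge> DIM('a) - 1" "W \<noteq> UNIV"
  shows "dim W = DIM('a) - 1"
proof -
  have "dim W \<noteq> DIM('a)" using assms dim_eq_full span_eq_iff by metis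
  then show ?thesis using assms(2) dim_subset_UNIV[of W] by linarith
qed

lemma distinct_hyperplanes_witness:
  fixes W1 W2 :: "'a::euclidean_space set"
  assumes "subspace W1" "dim W1 \<ge> DIM('a) - 1" and "subspace W2" "W2 \<noteq> UNIV" and "W1 \<noteq> W2"
  shows "\<exists>x \<in> W1. x \<notin> W2"
proof (rule ccontr)
  assume "\<not> ?thesis"
  then have "W1 \<subseteq> W2" by blast
  moreover have "dim W2 \<le> dim W1"
  proof -
    have "dim W2 \<noteq> DIM('a)" using assms(3,4) by (metis dim_eq_full span_eq_iff)
    then show ?thesis using assms(2) dim_subset_UNIV[of W2] by linarith
  qed
  ultimately show False using subspace_dim_equal assms by blast
qed

section \<open>Motions constrained to a space at each vertex\<close>

text \<open>Infinitesimal rigidity seen from the adjacency relation \<open>R\<close> and the constraint spaces \<open>W\<close>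
  alone: multiplicities of edges and the individual loops do not affect it.\<close>

definition rigid_on ::
    "'v set \<Rightarrow> ('v \<times> 'v) set \<Rightarrow> ('v \<Rightarrow> 'a::euclidean_space set) \<Rightarrow> ('v \<Rightarrow> 'a) \<Rightarrow> bool" where
  "rigid_on A R W p \<longleftrightarrow>
     (\<forall>m. (\<forall>x\<in>A. \<forall>w \<in> W x. w \<bullet> m x = 0) \<and>
          (\<forall>x\<in>A. \<forall>y\<in>A. (x, y) \<in> R \<longrightarrow> (p x - p y) \<bullet> (m x - m y) = 0) \<longrightarrow> (\<forall>x\<in>A. m x = 0))"

lemma avoid_finitely_many_hyperplanes:
  fixes a :: "'i \<Rightarrow> 'a::euclidean_space"
  assumes "finite I" and "\<And>i. i \<in> I \<Longrightarrow> a i \<noteq> 0"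
  shows "\<exists>x. \<forall>i\<in>I. a i \<bullet> x \<noteq> c i"
proof -
  have "negligible (\<Union>i\<in>I. {x. a i \<bullet> x = c i})"
    using assms by (intro negligible_Union) (auto intro: negligible_hyperplane)
  then have "(\<Union>i\<in>I. {x. a i \<bullet> x = c i}) \<noteq> UNIV"
    using non_negligible_UNIV by metis
  then show ?thesis by blast
qed

text \<open>The vertices of \<open>S\<close> are placed one at a time, each off finitely many hyperplanes determined by
  the vertices already placed; the remaining vertices keep their prescribed position \<open>p0\<close>.\<close>

lemma generic_placement:
  fixes n :: "'v \<Rightarrow> 'a::euclidean_space"
  assumes "finite A" and "S \<subseteq> A" and n: "\<And>x. x \<in> A \<Longrightarrow> n x \<noteq> 0"
  shows "\<exists>p. (\<forall>x. x \<notin> S \<longrightarrow> p x = p0 x) \<and>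
             (\<forall>x\<in>S. \<forall>y\<in>A. y \<noteq> x \<longrightarrow> (p x - p y) \<bullet> n x \<noteq> 0 \<and> (p x - p y) \<bullet> n y \<noteq> 0)"
proof -
  have "finite S" using assms finite_subset by blast
  then show ?thesis using \<open>S \<subseteq> A\<close>
  proof (induction S)
    case empty
    then show ?case by auto
  next
    case (insert s S)
    then obtain p where p: "\<forall>x. x \<notin> S \<longrightarrow> p x = p0 x"
      "\<forall>x\<in>S. \<forall>y\<in>A. y \<noteq> x \<longrightarrow> (p x - p y) \<bullet> n x \<noteq> 0 \<and> (p x - p y) \<bullet> n y \<noteq> 0"
      by auto
    obtain z where z: "\<forall>(x, y) \<in> A \<times> A. n x \<bullet> z \<noteq> n x \<bullet> p y"
      using avoid_finitely_many_hyperplanes[of "A \<times> A" "\<lambda>(x, y). n x" "\<lambda>(x, y). n x \<bullet> p y"]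
        \<open>finite A\<close> n by (auto simp: case_prod_beta)
    have sep: "(z - p y) \<bullet> n x \<noteq> 0" "(p y - z) \<bullet> n x \<noteq> 0" if "x \<in> A" "y \<in> A" for x y
    proof -
      have "n x \<bullet> z \<noteq> n x \<bullet> p y" using z that by simp
      then show "(z - p y) \<bullet> n x \<noteq> 0" "(p y - z) \<bullet> n x \<noteq> 0"
        by (simp_all add: inner_diff_right inner_commute[of _ "n x"])
    qed
    show ?case
    proof (intro exI[of _ "p(s := z)"] conjI ballI allI impI)
      fix x assume "x \<notin> insert s S"
      then show "(p(s := z)) x = p0 x" using p(1) by simp
    next
      fix x y assume xy: "x \<in> insert s S" "y \<in> A" "y \<noteq> x"
      have s: "s \<in> A" and x: "x \<in> A" using insert.prems xy(1) by auto
      consider "x = s" | "x \<noteq> s" "y = s" | "x \<noteq> s" "y \<noteq> s" by blast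
      then have "((p(s := z)) x - (p(s := z)) y) \<bullet> n x \<noteq> 0 \<and>
                 ((p(s := z)) x - (p(s := z)) y) \<bullet> n y \<noteq> 0"
      proof cases
        case 1
        then show ?thesis using 1(1) sep s xy by auto
      next
        case 2
        then show ?thesis using sep s x by auto
      next
        case 3
        then show ?thesis using p(2) xy by simp
      qed
      then show "((p(s := z)) x - (p(s := z)) y) \<bullet> n x \<noteq> 0"
        and "((p(s := z)) x - (p(s := z)) y) \<bullet> n y \<noteq> 0" by blast+
    qed
  qed
qed

text \<open>Once \<open>m y = 0\<close>, the equation of \<open>y\<close> and \<open>z\<close> only involves the scalar of \<open>m z\<close>. Only the
  coefficient at the head \<open>z\<close> of an arc has to be nonzero, so propagation is directed: this is why
  \<open>R\<close> may lack the reverse of some of its arcs.\<close>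

lemma zero_propagates:
  fixes p m n :: "'v \<Rightarrow> 'a::euclidean_space"
  assumes "(r, x) \<in> R\<^sup>*" and "m r = 0"
    and "\<And>y z. (y, z) \<in> R \<Longrightarrow> (p y - p z) \<bullet> (m y - m z) = 0"
    and "\<And>y z. (y, z) \<in> R \<Longrightarrow> (p y - p z) \<bullet> n z \<noteq> 0"
    and "\<And>y z. (y, z) \<in> R \<Longrightarrow> \<exists>t. m z = t *\<^sub>R n z"
  shows "m x = 0"
  using assms(1)
proof (induction rule: rtrancl_induct)
  case base
  show ?case by fact
next
  case (step y z)
  obtain t where t: "m z = t *\<^sub>R n z" using assms(5)[OF step.hyps(2)] by blast
  have "(p y - p z) \<bullet> (m y - m z) = 0" "(p y - p z) \<bullet> n z \<noteq> 0"
    using assms(3,4) step.hyps(2) by blast+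
  then have "t = 0" using step.IH t by (simp add: inner_diff_right)
  then show ?case using t by simp
qed

locale constrained_vertices =
  fixes A :: "'v set" and R :: "('v \<times> 'v) set" and W :: "'v \<Rightarrow> 'a::euclidean_space set"
  assumes finite_A: "finite A"
    and R_subset: "R \<subseteq> A \<times> A"
    and R_sym: "sym R"
    and R_irrefl: "irrefl R"
    and subspace_W: "x \<in> A \<Longrightarrow> subspace (W x)"
    and dim_W: "x \<in> A \<Longrightarrow> dim (W x) \<ge> DIM('a) - 1"
begin

lemma R_in: "(x, y) \<in> R \<Longrightarrow> x \<in> A \<and> y \<in> A \<and> x \<noteq> y"
  using R_subset R_irrefl by (auto simp: irrefl_def)

lemma normal_nz: "x \<in> A \<Longrightarrow> normal (W x) \<noteq> 0"
  by (rule normal_nonzero[OF subspace_W dim_W])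

lemma motion_along_normal:
  assumes "x \<in> A" "\<forall>x\<in>A. \<forall>w \<in> W x. w \<bullet> m x = 0"
  shows "\<exists>t. m x = t *\<^sub>R normal (W x)"
  by (rule orthogonal_imp_multiple_of_normal[OF subspace_W dim_W]) (use assms in auto)

lemma mem_W_iff: "x \<in> A \<Longrightarrow> W x \<noteq> UNIV \<Longrightarrow> z \<in> W x \<longleftrightarrow> z \<bullet> normal (W x) = 0"
  by (subst hyperplane_eq_normal[OF subspace_W dim_W, of x]) (simp_all add: inner_commute)

lemma rigid_if_pinned_vertex:
  assumes r: "r \<in> A" "W r = UNIV" and reach: "\<And>x. x \<in> A \<Longrightarrow> (r, x) \<in> R\<^sup>*"
  shows "\<exists>p. rigid_on A R W p"
proof -
  obtain p where p: "\<forall>x\<in>A. \<forall>y\<in>A. y \<noteq> x \<longrightarrow>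
      (p x - p y) \<bullet> normal (W x) \<noteq> 0 \<and> (p x - p y) \<bullet> normal (W y) \<noteq> 0"
    using generic_placement[where n = "\<lambda>x. normal (W x)" and ?p0.0 = "\<lambda>_. 0",
        OF finite_A subset_refl normal_nz] by auto
  have "rigid_on A R W p"
    unfolding rigid_on_def
  proof (intro allI impI ballI, elim conjE)
    fix m x
    assume m: "\<forall>x\<in>A. \<forall>w\<in>W x. w \<bullet> m x = 0"
      "\<forall>x\<in>A. \<forall>y\<in>A. (x, y) \<in> R \<longrightarrow> (p x - p y) \<bullet> (m x - m y) = 0" and x: "x \<in> A"
    have "m r \<bullet> m r = 0" using m(1) r by simp
    then have "m r = 0" by simp
    then show "m x = 0"
    proof (rule zero_propagates[OF reach[OF x], where p = p and n = "\<lambda>x. normal (W x)"])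
      fix y z assume yz: "(y, z) \<in> R"
      then have in_A: "y \<in> A" "z \<in> A" "y \<noteq> z" using R_in by blast+
      show "(p y - p z) \<bullet> (m y - m z) = 0" using m(2) in_A yz by simp
      show "(p y - p z) \<bullet> normal (W z) \<noteq> 0" using p in_A by simp
      show "\<exists>t. m z = t *\<^sub>R normal (W z)" using in_A(2) m(1) by (rule motion_along_normal)
    qed
  qed
  then show ?thesis by (intro exI)
qed

text \<open>The scalar at \<open>b\<close> is forced to be zero by placing \<open>b - a\<close> orthogonal to the normal at \<open>a\<close>
  only. The price is that a zero can no longer pass from \<open>b\<close> to \<open>a\<close> directly; all other arcs,
  including the one from \<open>a\<close> to \<open>b\<close>, still transport it.\<close>

lemma rigid_if_detour:
  assumes ab: "(a, b) \<in> R" and W: "W a \<noteq> W b" "W b \<noteq> UNIV" "W a \<noteq> UNIV"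
    and reach: "\<And>x. x \<in> A \<Longrightarrow> (b, x) \<in> (R - {(b, a)})\<^sup>*"
  shows "\<exists>p. rigid_on A R W p"
proof -
  have A: "a \<in> A" "b \<in> A" "a \<noteq> b" using R_in ab by blast+
  obtain z where z: "z \<in> W a" "z \<notin> W b"
    
    using distinct_hyperplanes_witness[OF subspace_W[OF A(1)] dim_W[OF A(1)]
        subspace_W[OF A(2)] W(2,1)] by blast
  have za: "z \<bullet> normal (W a) = 0"
    using z(1) mem_W_iff A(1) W(3) by blast
  have zb: "z \<bullet> normal (W b) \<noteq> 0"
    using z(2) mem_W_iff A(2) W(2) by blast
  obtain p where p0: "\<forall>x. x \<notin> A - {a, b} \<longrightarrow> p x = (if x = b then z else 0)"
    and p: "\<forall>x\<in>A - {a, b}. \<forall>y\<in>A. y \<noteq> x \<longrightarrow>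
      (p x - p y) \<bullet> normal (W x) \<noteq> 0 \<and> (p x - p y) \<bullet> normal (W y) \<noteq> 0"
    using generic_placement[where n = "\<lambda>x. normal (W x)"
        and ?p0.0 = "\<lambda>x. if x = b then z else 0",
        OF finite_A Diff_subset[of A "{a, b}"] normal_nz] by auto
  have pab: "p a = 0" "p b = z" using p0 A by auto
  have p': "(p x - p y) \<bullet> normal (W y) \<noteq> 0" if "(x, y) \<in> R - {(b, a)}" for x y
  proof -
    have xy: "x \<in> A" "y \<in> A" "x \<noteq> y" "(x, y) \<noteq> (b, a)" using that R_in by auto
    consider "x \<notin> {a, b}" | "y \<notin> {a, b}" | "x = a" "y = b" using xy by blast
    then show ?thesis
    proof cases
      case 1
      then show ?thesis using p xy by simp
    next
      case 2
      then have "(p y - p x) \<bullet> normal (W y) \<noteq> 0" using p xy by simp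
      then show ?thesis by (simp add: inner_diff_left)
    next
      case 3
      then show ?thesis using pab zb by simp
    qed
  qed
  have "rigid_on A R W p"
    unfolding rigid_on_def
  proof (intro allI impI ballI, elim conjE)
    fix m x
    assume m: "\<forall>x\<in>A. \<forall>w\<in>W x. w \<bullet> m x = 0"
      "\<forall>x\<in>A. \<forall>y\<in>A. (x, y) \<in> R \<longrightarrow> (p x - p y) \<bullet> (m x - m y) = 0" and x: "x \<in> A"
    obtain s t where st: "m a = s *\<^sub>R normal (W a)" "m b = t *\<^sub>R normal (W b)"
      using motion_along_normal[OF A(1) m(1)] motion_along_normal[OF A(2) m(1)] by blast
    have "(p a - p b) \<bullet> (m a - m b) = 0" using m(2) ab A by simp
    then have "t = 0" using za zb st pab by (simp add: inner_diff_right)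
    then have "m b = 0" using st by simp
    then show "m x = 0"
    proof (rule zero_propagates[OF reach[OF x], where p = p and n = "\<lambda>x. normal (W x)"])
      fix y z assume yz: "(y, z) \<in> R - {(b, a)}"
      then have in_A: "y \<in> A" "z \<in> A" "y \<noteq> z" using R_in by blast+
      show "(p y - p z) \<bullet> (m y - m z) = 0" using m(2) in_A yz by simp
      show "(p y - p z) \<bullet> normal (W z) \<noteq> 0" by (rule p'[OF yz])
      show "\<exists>t. m z = t *\<^sub>R normal (W z)" using in_A(2) m(1) by (rule motion_along_normal)
    qed
  qed
  then show ?thesis by (intro exI)
qed

end

text \<open>Induction on the number of vertices, cutting \<open>R\<close> at a bridge whose ends have different normals.
  The equation of the bridge, one equation in the two scaling factors of the parts, has a nonzero
  solution for every \<open>p\<close>, even where its coefficients vanish.\<close>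

lemma flex_along_normals:
  fixes p n :: "'v \<Rightarrow> 'a::euclidean_space"
  assumes "finite A" "A \<noteq> {}" "R \<subseteq> A \<times> A" "sym R"
    and "\<And>u v. (u, v) \<in> R \<Longrightarrow> n u \<noteq> n v \<Longrightarrow> (v, u) \<notin> (R - {(u, v), (v, u)})\<^sup>*"
  shows "\<exists>t. (\<exists>x\<in>A. t x \<noteq> 0) \<and> (\<forall>(x, y) \<in> R. (p x - p y) \<bullet> (t x *\<^sub>R n x - t y *\<^sub>R n y) = 0)"
  using assms
proof (induction "card A" arbitrary: A R rule: less_induct)
  case less
  note sym = symD[OF less.prems(4)]
  show ?case
  proof (cases "\<exists>(u, v) \<in> R. n u \<noteq> n v")
    case False
    then have "\<forall>(x, y) \<in> R. (p x - p y) \<bullet> (1 *\<^sub>R n x - 1 *\<^sub>R n y) = 0" by auto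
    then show ?thesis using less.prems(2) by (intro exI[of _ "\<lambda>_. 1"]) auto
  next
    case True
    then obtain u v where uv: "(u, v) \<in> R" "n u \<noteq> n v" by blast
    define R' where "R' = R - {(u, v), (v, u)}"
    define B where "B = {x \<in> A. (v, x) \<in> R'\<^sup>*}"
    have A: "u \<in> A" "v \<in> A" using uv less.prems(3) by auto
    have vB: "v \<in> B" using A B_def by simp
    have uB: "u \<notin> B" using less.prems(5)[OF uv] B_def R'_def by simp
    \<comment> \<open>The pair \<open>u, v\<close> is a bridge: no other adjacency leaves \<open>B\<close>.\<close>
    have cut: "x = v \<and> y = u" if "(x, y) \<in> R" "x \<in> B" "y \<notin> B" for x y
    proof (rule ccontr)
      assume "\<not> ?thesis"
      then have "(x, y) \<in> R'" using that uB by (auto simp: R'_def)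
      then have "(v, y) \<in> R'\<^sup>*" using that by (auto simp: B_def intro: rtrancl_into_rtrancl)
      then show False using that less.prems(3) by (auto simp: B_def)
    qed
    have IH: "\<exists>t. (\<exists>x\<in>D. t x \<noteq> 0) \<and>
        (\<forall>(x, y) \<in> R \<inter> D \<times> D. (p x - p y) \<bullet> (t x *\<^sub>R n x - t y *\<^sub>R n y) = 0)"
      if D: "D \<subseteq> A" "D \<noteq> A" "D \<noteq> {}" for D
    proof (rule less.hyps)
      show "card D < card A" using D less.prems(1) by (simp add: psubset_card_mono psubsetI)
      show "finite D" using D less.prems(1) finite_subset by blast
      show "sym (R \<inter> D \<times> D)" using sym by (auto intro!: symI)
      show "(y, x) \<notin> (R \<inter> D \<times> D - {(x, y), (y, x)})\<^sup>*"
        if "(x, y) \<in> R \<inter> D \<times> D" "n x \<noteq> n y" for x y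
        using less.prems(5)[of x y] that
          rtrancl_mono[of "R \<inter> D \<times> D - {(x, y), (y, x)}" "R - {(x, y), (y, x)}"] by blast
    qed (use D in auto)
    have "B \<subseteq> A" "B \<noteq> A" "B \<noteq> {}" using A uB vB by (auto simp: B_def)
    from IH[OF this] obtain f where f: "\<exists>x\<in>B. f x \<noteq> 0"
      "\<forall>(x, y) \<in> R \<inter> B \<times> B. (p x - p y) \<bullet> (f x *\<^sub>R n x - f y *\<^sub>R n y) = 0" by blast
    have "A - B \<subseteq> A" "A - B \<noteq> A" "A - B \<noteq> {}" using A uB vB by auto
    from IH[OF this] obtain g where g: "\<exists>x\<in>A-B. g x \<noteq> 0"
      "\<forall>(x, y) \<in> R \<inter> (A-B) \<times> (A-B). (p x - p y) \<bullet> (g x *\<^sub>R n x - g y *\<^sub>R n y) = 0" by blast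
    define c where "c = g u * ((p u - p v) \<bullet> n u)"
    define d where "d = f v * ((p u - p v) \<bullet> n v)"
    obtain \<alpha> \<beta> where \<alpha>\<beta>: "\<alpha> * c = \<beta> * d" "\<alpha> \<noteq> 0 \<or> \<beta> \<noteq> 0"
    proof (cases "c = 0 \<and> d = 0")
      case True
      then show ?thesis using that[of 1 1] by simp
    next
      case False
      then show ?thesis using that[of d c] by auto
    qed
    define t where "t x = (if x \<in> B then \<beta> * f x else \<alpha> * g x)" for x
    have bridge: "(p u - p v) \<bullet> (t u *\<^sub>R n u - t v *\<^sub>R n v) = 0"
      using \<alpha>\<beta>(1) uB vB by (simp add: t_def c_def d_def inner_diff_right mult.assoc)
    have "(p x - p y) \<bullet> (t x *\<^sub>R n x - t y *\<^sub>R n y) = 0" if xy: "(x, y) \<in> R" for x y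
    proof -
      have xyA: "x \<in> A" "y \<in> A" using xy less.prems(3) by auto
      consider "x \<in> B" "y \<in> B" | "x \<notin> B" "y \<notin> B" | "x \<in> B" "y \<notin> B" | "x \<notin> B" "y \<in> B" by blast
      then show ?thesis
      proof cases
        case 1
        then have "(p x - p y) \<bullet> (f x *\<^sub>R n x - f y *\<^sub>R n y) = 0" using f(2) xy by blast
        then show ?thesis using 1 by (simp add: t_def inner_diff_right flip: right_diff_distrib)
      next
        case 2
        then have "(p x - p y) \<bullet> (g x *\<^sub>R n x - g y *\<^sub>R n y) = 0" using g(2) xy xyA by blast
        then show ?thesis using 2 by (simp add: t_def inner_diff_right flip: right_diff_distrib)
      next
        case 3
        then have "x = v" "y = u" using cut xy by blast+
        then show ?thesis
          using bridge by (metis inner_minus_left inner_minus_right minus_diff_eq minus_zero)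
      next
        case 4
        then have "x = u" "y = v" using cut[of y x] sym xy by blast+
        then show ?thesis using bridge by simp
      qed
    qed
    moreover have "\<exists>x\<in>A. t x \<noteq> 0"
      using \<alpha>\<beta>(2) f(1) g(1) by (auto simp: t_def B_def)
    ultimately show ?thesis by blast
  qed
qed

section \<open>Adjacency and connected components\<close>

definition adj :: "('v, 'e, 'l) mgraph \<Rightarrow> ('v \<times> 'v) set" where
  "adj G = {(x, y). \<exists>e \<in> edges G. ends G e = {x, y}}"

lemma sym_adj: "sym (adj G)"
  by (auto simp: adj_def insert_commute intro!: symI)

lemma adj_verts:
  assumes "is_graph G" "(x, y) \<in> adj G"
  shows "x \<in> verts G" "y \<in> verts G" "x \<noteq> y"
proof -
  obtain e where e: "e \<in> edges G" "ends G e = {x, y}" using assms by (auto simp: adj_def)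
  then have "{x, y} \<subseteq> verts G" "card {x, y} = 2" using assms(1) unfolding is_graph_def by metis+
  then show "x \<in> verts G" "y \<in> verts G" "x \<noteq> y" by auto
qed

lemma edge_ends:
  assumes "is_graph G" "e \<in> edges G"
  obtains x y where "ends G e = {x, y}" "x \<noteq> y" "(x, y) \<in> adj G"
proof -
  have "card (ends G e) = 2" using assms by (auto simp: is_graph_def)
  then obtain x y where "ends G e = {x, y}" "x \<noteq> y" by (meson card_2_iff)
  then show ?thesis using that assms(2) by (auto simp: adj_def)
qed

lemma connected_graph_iff_adj:
  "connected_graph G \<longleftrightarrow>
     is_graph G \<and> verts G \<noteq> {} \<and> (\<forall>u\<in>verts G. \<forall>v\<in>verts G. (u, v) \<in> (adj G)\<^sup>*)"
  by (simp add: connected_graph_def adj_def)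

lemma constrained_vertices_adj:
  fixes W :: "'v \<Rightarrow> 'a::euclidean_space set"
  assumes "is_graph H" and "\<And>x. x \<in> verts H \<Longrightarrow> dim (W x) \<ge> DIM('a) - 1"
    and "\<And>x. x \<in> verts H \<Longrightarrow> subspace (W x)"
  shows "constrained_vertices (verts H) (adj H) W"
proof
  show "finite (verts H)" using assms(1) by (simp add: is_graph_def)
  show "adj H \<subseteq> verts H \<times> verts H" using adj_verts[OF assms(1)] by auto
  show "irrefl (adj H)" using adj_verts(3)[OF assms(1)] by (auto simp: irrefl_def)
qed (use assms sym_adj in auto)

lemma subgraphD:
  assumes "subgraph H G"
  shows "is_graph H" "verts H \<subseteq> verts G" "edges H \<subseteq> edges G" "loops H \<subseteq> loops G"
    and "\<And>e. e \<in> edges H \<Longrightarrow> ends H e = ends G e"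
    and "\<And>l. l \<in> loops H \<Longrightarrow> base H l = base G l"
    and "\<And>e. e \<in> edges H \<Longrightarrow> ends G e \<subseteq> verts H \<and> card (ends G e) = 2"
    and "\<And>l. l \<in> loops H \<Longrightarrow> base G l \<in> verts H"
proof -
  show H: "is_graph H" "verts H \<subseteq> verts G" "edges H \<subseteq> edges G" "loops H \<subseteq> loops G"
    and e: "\<And>e. e \<in> edges H \<Longrightarrow> ends H e = ends G e"
    and l: "\<And>l. l \<in> loops H \<Longrightarrow> base H l = base G l"
    using assms by (simp_all add: subgraph_def)
  show "ends G e \<subseteq> verts H \<and> card (ends G e) = 2" if "e \<in> edges H" for e
  proof -
    have "ends H e \<subseteq> verts H \<and> card (ends H e) = 2"
      using H(1) that by (simp add: is_graph_def)
    then show ?thesis using e[OF that] by simp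
  qed
  show "base G l \<in> verts H" if "l \<in> loops H" for l
  proof -
    have "base H l \<in> verts H" using H(1) that by (simp add: is_graph_def)
    then show ?thesis using l[OF that] by simp
  qed
qed

lemma subgraph_trans:
  assumes "subgraph A B" and "subgraph B C" shows "subgraph A C"
  unfolding subgraph_def
proof (intro conjI ballI)
  fix e assume e: "e \<in> edges A"
  then have "e \<in> edges B" using subgraphD(3)[OF assms(1)] by blast
  then show "ends A e = ends C e"
    using e subgraphD(5)[OF assms(1)] subgraphD(5)[OF assms(2)] by simp
next
  fix l assume l: "l \<in> loops A"
  then have "l \<in> loops B" using subgraphD(4)[OF assms(1)] by blast
  then show "base A l = base C l"
    using l subgraphD(6)[OF assms(1)] subgraphD(6)[OF assms(2)] by simp
qed (use subgraphD(1-4)[OF assms(1)] subgraphD(2-4)[OF assms(2)] in \<open>blast+\<close>)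

lemma adj_subgraph: "subgraph H G \<Longrightarrow> adj H \<subseteq> adj G"
  unfolding subgraph_def adj_def by auto

definition reach :: "('v, 'e, 'l) mgraph \<Rightarrow> 'v \<Rightarrow> 'v set" where
  "reach G v = {x. (v, x) \<in> (adj G)\<^sup>*}"

definition component_of :: "('v, 'e, 'l) mgraph \<Rightarrow> 'v \<Rightarrow> ('v, 'e, 'l) mgraph" where
  "component_of G v =
     \<lparr>verts = reach G v, edges = {e \<in> edges G. ends G e \<subseteq> reach G v},
      loops = {l \<in> loops G. base G l \<in> reach G v}, ends = ends G, base = base G\<rparr>"

lemma component_of_simps [simp]:
  "verts (component_of G v) = reach G v"
  "edges (component_of G v) = {e \<in> edges G. ends G e \<subseteq> reach G v}"
  "loops (component_of G v) = {l \<in> loops G. base G l \<in> reach G v}"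
  "ends (component_of G v) = ends G" "base (component_of G v) = base G"
  by (simp_all add: component_of_def)

lemma reach_self: "v \<in> reach G v"
  by (simp add: reach_def)

lemma reach_step: "x \<in> reach G v \<Longrightarrow> (x, y) \<in> adj G \<Longrightarrow> y \<in> reach G v"
  by (auto simp: reach_def intro: rtrancl_into_rtrancl)

lemma reach_eq:
  assumes "x \<in> reach G v" shows "reach G x = reach G v"
proof -
  have 1: "(v, x) \<in> (adj G)\<^sup>*" using assms by (simp add: reach_def)
  then have "(x, v) \<in> (adj G)\<^sup>*" using sym_rtrancl[OF sym_adj, of G] by (meson symD)
  then show ?thesis using 1 unfolding reach_def by (auto intro: rtrancl_trans)
qed

lemma adj_component_of: "adj (component_of G v) = adj G \<inter> reach G v \<times> reach G v"
  by (auto simp: adj_def)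

lemma reach_subset: "is_graph G \<Longrightarrow> v \<in> verts G \<Longrightarrow> reach G v \<subseteq> verts G"
proof
  fix x assume G: "is_graph G" "v \<in> verts G" and "x \<in> reach G v"
  then have "(v, x) \<in> (adj G)\<^sup>*" by (simp add: reach_def)
  then show "x \<in> verts G" by (induction rule: rtrancl_induct) (use G adj_verts in auto)
qed

lemma subgraph_component_of:
  assumes "is_graph G" "v \<in> verts G" shows "subgraph (component_of G v) G"
  using assms reach_subset[OF assms] finite_subset[of "reach G v" "verts G"]
  by (auto simp: subgraph_def is_graph_def)

lemma connected_graph_component_of:
  assumes "is_graph G" "v \<in> verts G" shows "connected_graph (component_of G v)"
proof -
  have 1: "(v, x) \<in> (adj (component_of G v))\<^sup>*" if "(v, x) \<in> (adj G)\<^sup>*" for x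
    using that
  proof (induction rule: rtrancl_induct)
    case (step y z)
    then have "y \<in> reach G v" by (simp add: reach_def)
    then have "(y, z) \<in> adj (component_of G v)"
      using step reach_step by (auto simp: adj_component_of)
    then show ?case using step.IH by (rule rtrancl_into_rtrancl[rotated])
  qed simp
  have "(x, y) \<in> (adj (component_of G v))\<^sup>*" if "x \<in> reach G v" "y \<in> reach G v" for x y
  proof -
    have "(v, x) \<in> (adj (component_of G v))\<^sup>*" "(v, y) \<in> (adj (component_of G v))\<^sup>*"
      using 1 that by (auto simp: reach_def)
    then show ?thesis
      using symD[OF sym_rtrancl[OF sym_adj]] by (metis rtrancl_trans)
  qed
  then show ?thesis
    using subgraph_component_of[OF assms] reach_self[of v G]
    by (auto simp: connected_graph_iff_adj subgraph_def)
qed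

lemma connected_subgraph_in_component_of:
  assumes G: "is_graph G" and H: "subgraph H G" "connected_graph H" and v: "v \<in> verts H"
  shows "subgraph H (component_of G v)"
proof -
  have "verts H \<subseteq> reach G v"
  proof
    fix x assume "x \<in> verts H"
    then have "(v, x) \<in> (adj H)\<^sup>*" using H(2) v unfolding connected_graph_iff_adj by blast
    then show "x \<in> reach G v"
      using rtrancl_mono[OF adj_subgraph[OF H(1)]] unfolding reach_def by blast
  qed
  then show ?thesis
    using subgraphD[OF H(1)] by (fastforce simp: subgraph_def)
qed

text \<open>Every connected subgraph that contains \<open>v\<close> lies in \<open>component_of G v\<close>, which is connected
  itself. So these graphs are maximal, and each component is one of them up to the values of the
  incidence functions outside it.\<close>

lemma component_of_is_component:
  assumes "is_graph G" "v \<in> verts G"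
  shows "connected_component_of_graph (component_of G v) G"
proof -
  have "subgraph H' (component_of G v)"
    if "subgraph H' G" "connected_graph H'" and sub: "subgraph (component_of G v) H'" for H'
  proof -
    have "v \<in> verts H'" using subgraphD(2)[OF sub] reach_self[of v G] by auto
    then show ?thesis by (rule connected_subgraph_in_component_of[OF assms(1) that(1,2)])
  qed
  then show ?thesis
    using subgraph_component_of[OF assms] connected_graph_component_of[OF assms]
    by (simp add: connected_component_of_graph_def)
qed

lemma component_eq_component_of:
  assumes "is_graph G" "connected_component_of_graph H G"
  obtains v where "v \<in> verts G" "subgraph H (component_of G v)" "subgraph (component_of G v) H"
proof -
  have H: "subgraph H G" "connected_graph H"
    using assms(2) by (auto simp: connected_component_of_graph_def)
  then obtain v where v: "v \<in> verts H" by (auto simp: connected_graph_def)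
  then have vG: "v \<in> verts G" using subgraphD(2)[OF H(1)] by blast
  have sub: "subgraph H (component_of G v)"
    using connected_subgraph_in_component_of[OF assms(1) H v] .
  then have "subgraph (component_of G v) H"
    using assms(2) subgraph_component_of[OF assms(1) vG] connected_graph_component_of[OF assms(1) vG]
    by (simp add: connected_component_of_graph_def)
  then show ?thesis using that vG sub by blast
qed

lemma all_components_iff:
  assumes "is_graph G"
  shows "(\<forall>H. connected_component_of_graph H G \<longrightarrow> (\<exists>C k. subgraph C H \<and> P C k)) \<longleftrightarrow>
         (\<forall>v \<in> verts G. \<exists>C k. subgraph C (component_of G v) \<and> P C k)"
proof (intro iffI allI impI ballI)
  fix v assume "\<forall>H. connected_component_of_graph H G \<longrightarrow> (\<exists>C k. subgraph C H \<and> P C k)"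
    and "v \<in> verts G"
  then show "\<exists>C k. subgraph C (component_of G v) \<and> P C k"
    using component_of_is_component[OF assms] by blast
next
  fix H assume v: "\<forall>v \<in> verts G. \<exists>C k. subgraph C (component_of G v) \<and> P C k"
    and "connected_component_of_graph H G"
  then obtain v where "v \<in> verts G" "subgraph (component_of G v) H"
    using component_eq_component_of assms by blast
  then show "\<exists>C k. subgraph C H \<and> P C k" using v subgraph_trans by blast
qed

text \<open>A motion of a component extends by zero, since no adjacency leaves the component. Conversely,
  placements of the components are combined by placing each vertex as in its own component.\<close>

lemma rigid_iff_components_rigid:
  fixes W :: "'v \<Rightarrow> 'a::euclidean_space set"
  assumes G: "is_graph G"
  shows "(\<exists>p. rigid_on (verts G) (adj G) W p) \<longleftrightarrow>
         (\<forall>v \<in> verts G. \<exists>p. rigid_on (verts (component_of G v)) (adj (component_of G v)) W p)"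
proof (intro iffI ballI)
  fix v assume v: "v \<in> verts G" and "\<exists>p. rigid_on (verts G) (adj G) W p"
  then obtain p where p: "rigid_on (verts G) (adj G) W p" by blast
  have "rigid_on (verts (component_of G v)) (adj (component_of G v)) W p"
    unfolding rigid_on_def
  proof (intro allI impI, elim conjE)
    fix m
    assume m: "\<forall>x\<in>verts (component_of G v). \<forall>w\<in>W x. w \<bullet> m x = 0"
      "\<forall>x\<in>verts (component_of G v). \<forall>y\<in>verts (component_of G v).
          (x, y) \<in> adj (component_of G v) \<longrightarrow> (p x - p y) \<bullet> (m x - m y) = 0"
    define m' where "m' x = (if x \<in> reach G v then m x else 0)" for x
    have "\<forall>x\<in>verts G. \<forall>w\<in>W x. w \<bullet> m' x = 0" using m(1) by (simp add: m'_def)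
    moreover have "(p x - p y) \<bullet> (m' x - m' y) = 0" if xy: "(x, y) \<in> adj G" for x y
    proof -
      have "x \<in> reach G v \<longleftrightarrow> y \<in> reach G v"
        using reach_step xy symD[OF sym_adj xy] by metis
      then show ?thesis using m(2) xy by (auto simp: m'_def adj_component_of)
    qed
    ultimately have "\<forall>x\<in>verts G. m' x = 0" using p unfolding rigid_on_def by blast
    then show "\<forall>x\<in>verts (component_of G v). m x = 0"
      using reach_subset[OF G v] by (auto simp: m'_def split: if_splits)
  qed
  then show "\<exists>p. rigid_on (verts (component_of G v)) (adj (component_of G v)) W p" by blast
next
  assume "\<forall>v \<in> verts G. \<exists>p. rigid_on (verts (component_of G v)) (adj (component_of G v)) W p"
  then have "\<forall>v \<in> verts G. \<exists>p. rigid_on (reach G v) (adj G \<inter> reach G v \<times> reach G v) W p"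
    by (simp add: adj_component_of)
  then have "\<forall>A \<in> reach G ` verts G. \<exists>p. rigid_on A (adj G \<inter> A \<times> A) W p" by simp
  then obtain P where P: "\<And>A. A \<in> reach G ` verts G \<Longrightarrow> rigid_on A (adj G \<inter> A \<times> A) W (P A)"
    by metis
  define p where "p x = P (reach G x) x" for x
  have "rigid_on (verts G) (adj G) W p"
    unfolding rigid_on_def
  proof (intro allI impI ballI, elim conjE)
    fix m v
    assume m: "\<forall>x\<in>verts G. \<forall>w\<in>W x. w \<bullet> m x = 0"
      "\<forall>x\<in>verts G. \<forall>y\<in>verts G. (x, y) \<in> adj G \<longrightarrow> (p x - p y) \<bullet> (m x - m y) = 0"
      and v: "v \<in> verts G"
    define A where "A = reach G v"
    have AG: "A \<subseteq> verts G" using reach_subset[OF G v] by (simp add: A_def)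
    have rig: "rigid_on A (adj G \<inter> A \<times> A) W (P A)" using P v by (simp add: A_def)
    have pA: "p x = P A x" if "x \<in> A" for x
      using reach_eq[of x G v] that by (simp add: p_def A_def)
    have "(P A x - P A y) \<bullet> (m x - m y) = 0"
      if "x \<in> A" "y \<in> A" "(x, y) \<in> adj G \<inter> A \<times> A" for x y
    proof -
      have "(p x - p y) \<bullet> (m x - m y) = 0" using m(2) that AG by blast
      then show ?thesis using pA that by simp
    qed
    moreover have "\<forall>x\<in>A. \<forall>w\<in>W x. w \<bullet> m x = 0" using m(1) AG by blast
    ultimately have "\<forall>x\<in>A. m x = 0"
      using rig[unfolded rigid_on_def, THEN spec, of m] by blast
    then show "m v = 0" using reach_self[of v G] by (simp add: A_def)
  qed
  then show "\<exists>p. rigid_on (verts G) (adj G) W p" by blast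
qed

section \<open>Cycles and detours\<close>

text \<open>A handshake argument. If \<open>u\<close> were not reachable, let \<open>B\<close> be the set of vertices that
  are. The degrees in \<open>B\<close> sum to an even number. The edges inside \<open>B\<close> and the loops count twice,
  so the edges that leave \<open>B\<close> are even in number. These are the edges between \<open>u\<close> and \<open>v\<close>, and
  there are one or two of them by the degree condition; two of them make up a cycle of length two.\<close>

lemma cycle_detour:
  assumes C: "is_cycle k C" "k \<noteq> 2" and uv: "(u, v) \<in> adj C"
  shows "(v, u) \<in> (adj C - {(v, u)})\<^sup>*"
proof (rule ccontr)
  assume no: "(v, u) \<notin> (adj C - {(v, u)})\<^sup>*"
  have G: "is_graph C" and conn: "connected_graph C" and k: "card (edges C) + card (loops C) = k"
    and deg: "\<And>x. x \<in> verts C \<Longrightarrow> degree C x = 2"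
    using C by (auto simp: is_cycle_def connected_graph_def)
  have fin: "finite (verts C)" "finite (edges C)" "finite (loops C)"
    using G by (auto simp: is_graph_def)
  note uvC = adj_verts[OF G uv]
  define B where "B = {x \<in> verts C. (v, x) \<in> (adj C - {(v, u)})\<^sup>*}"
  define J where "J = {e \<in> edges C. ends C e = {u, v}}"
  define inc where "inc x = {e \<in> edges C. x \<in> ends C e}" for x
  have vB: "v \<in> B" and uB: "u \<notin> B" using uvC no by (auto simp: B_def)
  have cut: "x = v \<and> y = u" if "(x, y) \<in> adj C" "x \<in> B" "y \<notin> B" for x y
  proof (rule ccontr)
    assume "\<not> ?thesis"
    then have "(v, y) \<in> (adj C - {(v, u)})\<^sup>*"
      using that by (auto simp: B_def intro: rtrancl_into_rtrancl)
    then show False using that adj_verts[OF G that(1)] by (auto simp: B_def)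
  qed
  have finB: "finite B" using fin by (auto simp: B_def)
  have "(\<Sum>x\<in>B. card (inc x)) = (\<Sum>x\<in>B. \<Sum>e\<in>edges C. if x \<in> ends C e then 1 else 0)"
  proof (rule sum.cong)
    fix x
    have "inc x = edges C \<inter> {e. x \<in> ends C e}" by (auto simp: inc_def)
    then show "card (inc x) = (\<Sum>e\<in>edges C. if x \<in> ends C e then 1 else 0)"
      using fin by (simp add: sum.If_cases)
  qed simp
  also have "\<dots> = (\<Sum>e\<in>edges C. \<Sum>x\<in>B. if x \<in> ends C e then 1 else 0)" by (rule sum.swap)
  also have "\<dots> = (\<Sum>e\<in>edges C. card (B \<inter> ends C e))"
    using finB by (simp add: sum.If_cases)
  also have "\<dots> = (\<Sum>e\<in>J. card (B \<inter> ends C e)) + (\<Sum>e\<in>edges C - J. card (B \<inter> ends C e))"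
    using fin by (subst sum.subset_diff[of J]) (auto simp: J_def)
  also have "(\<Sum>e\<in>J. card (B \<inter> ends C e)) = (\<Sum>e\<in>J. 1)"
  proof (rule sum.cong)
    fix e assume "e \<in> J"
    then have "B \<inter> ends C e = {v}" using uB vB by (auto simp: J_def)
    then show "card (B \<inter> ends C e) = 1" by simp
  qed simp
  finally have count: "(\<Sum>x\<in>B. card (inc x)) = card J + (\<Sum>e\<in>edges C - J. card (B \<inter> ends C e))"
    by simp
  have even1: "even (\<Sum>e\<in>edges C - J. card (B \<inter> ends C e))"
  proof (rule dvd_sum)
    fix e assume e: "e \<in> edges C - J"
    then obtain x y where xy: "ends C e = {x, y}" "x \<noteq> y" "(x, y) \<in> adj C"
      using edge_ends[OF G] by blast
    have "x \<in> B \<longleftrightarrow> y \<in> B"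
      using cut[OF xy(3)] cut[OF symD[OF sym_adj xy(3)]] e xy(1) by (auto simp: J_def)
    then have "B \<inter> ends C e = {} \<or> B \<inter> ends C e = {x, y}" using xy by auto
    then show "even (card (B \<inter> ends C e))" using xy by auto
  qed
  have "(\<Sum>x\<in>B. card (inc x)) + 2 * (\<Sum>x\<in>B. card (loops_at C x)) = (\<Sum>x\<in>B. degree C x)"
    by (simp add: sum_distrib_left degree_def inc_def sum.distrib)
  also have "\<dots> = 2 * card B" using deg by (simp add: B_def)
  finally have "even (\<Sum>x\<in>B. card (inc x))" by presburger
  then have evenJ: "even (card J)" using count even1 by simp
  have J: "J = inc x \<and> card J = 2 \<and> loops_at C x = {}" if x: "x \<in> {u, v}" for x
  proof -
    have sub: "J \<subseteq> inc x" using x by (auto simp: J_def inc_def)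
    have fi: "finite (inc x)" using fin by (simp add: inc_def)
    have "J \<noteq> {}" using uv by (auto simp: J_def adj_def)
    then have "card J \<noteq> 0" using finite_subset[OF sub fi] by simp
    moreover have d: "card (inc x) + 2 * card (loops_at C x) = 2"
      using deg[of x] x uvC by (auto simp: degree_def inc_def)
    moreover have "card J \<le> card (inc x)" using card_mono[OF fi sub] .
    moreover have "card J \<noteq> 1" using evenJ by auto
    ultimately have "card J = 2" "card (inc x) = 2" "card (loops_at C x) = 0" by linarith+
    moreover have "finite (loops_at C x)" using fin by (simp add: loops_at_def)
    ultimately show ?thesis using card_subset_eq[OF fi sub] by auto
  qed
  have inc_uv: "y \<in> {u, v}" if xy: "(x, y) \<in> adj C" and x: "x \<in> {u, v}" for x y
  proof -
    obtain e where e: "e \<in> edges C" "ends C e = {x, y}" using xy unfolding adj_def by blast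
    then have "e \<in> inc x" by (simp add: inc_def)
    then have "e \<in> J" using J x by blast
    then show ?thesis using e by (auto simp: J_def)
  qed
  have verts: "x \<in> {u, v}" if "x \<in> verts C" for x
  proof -
    have "(u, x) \<in> (adj C)\<^sup>*" using conn that uvC by (auto simp: connected_graph_iff_adj)
    then show ?thesis by (induction rule: rtrancl_induct) (use inc_uv in blast)+
  qed
  have "edges C \<subseteq> J"
  proof
    fix e assume e: "e \<in> edges C"
    then obtain x y where xy: "ends C e = {x, y}" "(x, y) \<in> adj C" using edge_ends[OF G] by metis
    then have "x \<in> {u, v}" using verts adj_verts[OF G] by blast
    then show "e \<in> J" using J[of x] e xy by (auto simp: inc_def)
  qed
  then have "edges C = J" by (auto simp: J_def)
  moreover have "loops C = {}"
  proof (rule ccontr)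
    assume "loops C \<noteq> {}"
    then obtain l where l: "l \<in> loops C" by blast
    then have "base C l \<in> verts C" using G by (auto simp: is_graph_def)
    then have "loops_at C (base C l) = {}" using J verts by blast
    then show False using l by (auto simp: loops_at_def)
  qed
  ultimately show False using J[of u] k C(2) by (metis add.right_neutral card.empty insertI1)
qed

lemma closed_path_is_cycle:
  fixes f :: "nat \<Rightarrow> 'v" and H :: "('v, 'e, 'l) mgraph"
  assumes H: "is_graph H" and N: "N \<ge> 3" and inj: "inj_on f {..<N}"
    and e: "\<And>i. i < N \<Longrightarrow> e i \<in> edges H \<and> ends H (e i) = {f i, f (if Suc i = N then 0 else Suc i)}"
  defines "C \<equiv> \<lparr>verts = f ` {..<N}, edges = e ` {..<N}, loops = {}, ends = ends H, base = base H\<rparr>"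
  shows "subgraph C H \<and> is_cycle N C"
proof -
  define s where "s i = (if Suc i = N then 0 else Suc i)" for i
  have s: "s i < N" if "i < N" for i using that by (auto simp: s_def)
  have es: "e i \<in> edges H" "ends H (e i) = f ` {i, s i}" if "i < N" for i
    using e[OF that] by (simp_all add: s_def)
  have inj_e: "inj_on e {..<N}"
  proof (rule inj_onI)
    fix i j assume ij: "i \<in> {..<N}" "j \<in> {..<N}" "e i = e j"
    then have "f ` {i, s i} = f ` {j, s j}" using es by (metis lessThan_iff)
    then have "{i, s i} = {j, s j}"
      using inj_on_image_eq_iff[OF inj, of "{i, s i}" "{j, s j}"] ij s by auto
    then have "i = j \<or> (i = s j \<and> j = s i)" by (auto simp: doubleton_eq_iff)
    then show "i = j" using ij N by (auto simp: s_def split: if_splits)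
  qed
  have card_ends: "card (ends H a) = 2" "ends H a \<subseteq> verts H" if "a \<in> edges H" for a
    using H that by (auto simp: is_graph_def)
  have vH: "f i \<in> verts H" if "i < N" for i
    using card_ends(2)[OF es(1)[OF that]] es(2)[OF that] by auto
  have gC: "is_graph C"
  proof -
    have "card (ends H a) = 2 \<and> ends H a \<subseteq> f ` {..<N}" if a: "a \<in> e ` {..<N}" for a
    proof -
      obtain i where i: "i < N" "a = e i" using a by blast
      have "ends H a \<subseteq> f ` {..<N}" using es(2)[OF i(1)] s[OF i(1)] i by auto
      then show ?thesis using card_ends(1)[of a] es(1)[OF i(1)] i(2) by simp
    qed
    then show ?thesis by (auto simp: is_graph_def C_def)
  qed
  have sub: "subgraph C H" using gC es vH by (auto simp: subgraph_def C_def)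
  have deg: "degree C (f j) = 2" if j: "j < N" for j
  proof -
    \<comment> \<open>The cyclic predecessor of \<open>j\<close>.\<close>
    define r where "r = (if j = 0 then N - 1 else j - 1)"
    have "{a \<in> edges C. f j \<in> ends C a} = e ` {i \<in> {..<N}. f j \<in> f ` {i, s i}}"
      using es by (auto simp: C_def)
    also have "{i \<in> {..<N}. f j \<in> f ` {i, s i}} = {i \<in> {..<N}. j \<in> {i, s i}}"
    proof (rule Collect_cong, rule conj_cong)
      fix i assume "i \<in> {..<N}"
      then show "f j \<in> f ` {i, s i} \<longleftrightarrow> j \<in> {i, s i}"
        using j s by (intro inj_on_image_mem_iff[OF inj]) auto
    qed simp
    also have "\<dots> = {j, r}"
      using j N by (auto simp: s_def r_def split: if_splits)
    finally have "card {a \<in> edges C. f j \<in> ends C a} = card (e ` {j, r})" by simp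
    also have "\<dots> = card {j, r}"
      using j N by (intro card_image inj_on_subset[OF inj_e]) (auto simp: r_def)
    also have "\<dots> = 2" using j N by (auto simp: r_def)
    finally show ?thesis by (simp add: degree_def loops_at_def C_def)
  qed
  have path: "(f 0, f i) \<in> (adj C)\<^sup>*" if "i < N" for i
    using that
  proof (induction i)
    case (Suc i)
    then have "ends H (e i) = {f i, f (Suc i)}" using e[of i] by auto
    then have "(f i, f (Suc i)) \<in> adj C" using Suc.prems by (auto simp: adj_def C_def)
    then show ?case using Suc by (meson Suc_lessD rtrancl.rtrancl_into_rtrancl)
  qed simp
  have conn: "connected_graph C"
    unfolding connected_graph_iff_adj
  proof (intro conjI ballI)
    fix x y assume "x \<in> verts C" "y \<in> verts C"
    then have "(f 0, x) \<in> (adj C)\<^sup>*" "(f 0, y) \<in> (adj C)\<^sup>*" using path by (auto simp: C_def)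
    then show "(x, y) \<in> (adj C)\<^sup>*"
      using symD[OF sym_rtrancl[OF sym_adj]] by (metis rtrancl_trans)
  next
    show "verts C \<noteq> {}" using N by (auto simp: C_def lessThan_empty_iff)
  qed (rule gC)
  have "card (edges C) + card (loops C) = N"
    using card_image[OF inj_e] by (simp add: C_def)
  then have "is_cycle N C" using conn deg by (auto simp: is_cycle_def C_def)
  then show ?thesis using sub by blast
qed

text \<open>A path of minimal length cannot visit a vertex twice.\<close>

lemma simple_path:
  assumes "(v, u) \<in> S\<^sup>*"
  shows "\<exists>f n. f 0 = v \<and> f n = u \<and> inj_on f {..n} \<and> (\<forall>i<n. (f i, f (Suc i)) \<in> S)"
proof -
  define n where "n = (LEAST n. (v, u) \<in> S ^^ n)"
  have n: "(v, u) \<in> S ^^ n"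
    unfolding n_def using assms by (metis LeastI rtrancl_imp_relpow)
  have least: "n \<le> k" if "(v, u) \<in> S ^^ k" for k
    unfolding n_def using that by (rule Least_le)
  obtain f where f: "f 0 = v" "f n = u" "\<forall>i<n. (f i, f (Suc i)) \<in> S"
    using n unfolding relpow_fun_conv by blast
  have segment: "(f i, f (i + k)) \<in> S ^^ k" if "i + k \<le> n" for i k
    using f(3) that unfolding relpow_fun_conv by (intro exI[of _ "\<lambda>j. f (i + j)"]) auto
  have False if ij: "i < j" "j \<le> n" "f i = f j" for i j
  proof -
    have "(v, f i) \<in> S ^^ i" using segment[of 0 i] ij f by simp
    moreover have "(f i, u) \<in> S ^^ (n - j)" using segment[of j "n - j"] ij f by simp
    ultimately have "(v, u) \<in> S ^^ (i + (n - j))" by (auto simp: relpow_add)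
    then show False using least ij by fastforce
  qed
  then have "inj_on f {..n}" by (metis atMost_iff inj_onI linorder_neqE_nat)
  then show ?thesis using f by blast
qed

text \<open>The cycle consists of the edge from \<open>u\<close> to \<open>v\<close> and a simple path back that avoids all edges
  between the two, and therefore has at least three vertices.\<close>

lemma cycle_through_non_bridge:
  assumes H: "is_graph H" and uv: "(u, v) \<in> adj H"
    and detour: "(v, u) \<in> (adj H - {(u, v), (v, u)})\<^sup>*"
  shows "\<exists>C k. subgraph C H \<and> is_cycle k C \<and> k \<noteq> 2 \<and> loops C = {} \<and> u \<in> verts C \<and> v \<in> verts C"
proof -
  obtain f n where f: "f 0 = v" "f n = u" "inj_on f {..n}"
    "\<forall>i<n. (f i, f (Suc i)) \<in> adj H - {(u, v), (v, u)}"
    using simple_path[OF detour] by blast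
  have "u \<noteq> v" using adj_verts[OF H uv] by simp
  then have "n \<noteq> 0" using f(1,2) by metis
  moreover have "n \<noteq> 1" using f by force
  ultimately have n: "n \<ge> 2" by linarith
  have "\<exists>a. a \<in> edges H \<and> ends H a = {f i, f (if Suc i = Suc n then 0 else Suc i)}"
    if "i < Suc n" for i
  proof (cases "i = n")
    case True
    then show ?thesis using uv f(1,2) by (auto simp: adj_def)
  next
    case False
    then have "(f i, f (Suc i)) \<in> adj H" using f(4) that by auto
    then show ?thesis using False by (auto simp: adj_def)
  qed
  then obtain e where e: "\<And>i. i < Suc n \<Longrightarrow>
      e i \<in> edges H \<and> ends H (e i) = {f i, f (if Suc i = Suc n then 0 else Suc i)}" by metis
  define C where "C = \<lparr>verts = f ` {..<Suc n}, edges = e ` {..<Suc n}, loops = {},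
      ends = ends H, base = base H\<rparr>"
  have "inj_on f {..<Suc n}" using f(3) by (simp add: lessThan_Suc_atMost)
  then have "subgraph C H \<and> is_cycle (Suc n) C"
    unfolding C_def by (intro closed_path_is_cycle[OF H] e) (use n in simp_all)
  moreover have "loops C = {}" "u \<in> verts C" "v \<in> verts C"
    using f(1,2) by (auto simp: C_def)
  moreover have "Suc n \<noteq> 2" using n by simp
  ultimately show ?thesis by blast
qed

section \<open>Copies of a subgraph with added loops\<close>

text \<open>The subset is indexed by loops rather than by vectors, because \<open>q\<close> may repeat a vector and
  copies of added loops are counted by loops.\<close>

lemma spanning_subset_of_loops:
  fixes q :: "'l \<Rightarrow> 'a::euclidean_space"
  shows "\<exists>B \<subseteq> L. finite B \<and> card B = dim (q ` L) \<and> span (q ` B) = span (q ` L)"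
proof -
  obtain D where D: "D \<subseteq> q ` L" "independent D" "q ` L \<subseteq> span D" "card D = dim (q ` L)"
    using basis_exists by blast
  then obtain B where B: "B \<subseteq> L" "inj_on q B" "D = q ` B" by (auto simp: subset_image_inj)
  have "finite D" using D(2) independent_bound by blast
  then have "finite B" using B finite_imageD by blast
  moreover have "card B = dim (q ` L)" using B D card_image by metis
  moreover have "span (q ` B) = span (q ` L)"
  proof (rule subset_antisym)
    show "span (q ` L) \<subseteq> span (q ` B)" using D(3) B(3) by (simp add: span_minimal)
  qed (use B(1) in \<open>auto intro!: span_mono\<close>)
  ultimately show ?thesis using B(1) by blast
qed

lemma loops_at_add_loops:
  "loops_at (add_loops k G) v =
     Inl ` loops_at G v \<union> (if v \<in> verts G then Inr ` ({v} \<times> {..<k}) else {})"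
  by (auto simp: loops_at_def add_loops_def)

lemma is_graph_add_loops: "is_graph G \<Longrightarrow> is_graph (add_loops k G)"
  by (auto simp: is_graph_def add_loops_def)

lemma add_loops_copy_exists:
  assumes G: "is_graph G" and C: "subgraph C G"
    and B: "\<And>v. v \<in> verts C \<Longrightarrow> B v \<subseteq> loops_at (add_loops k G) v - Inl ` loops C \<and> card (B v) = k"
  shows "\<exists>K. add_loops_copy k G C K \<and> (\<forall>v\<in>verts C. loops_at K v = B v \<union> Inl ` loops_at C v)"
proof -
  define K where "K = \<lparr>verts = verts C, edges = edges C,
      loops = Inl ` loops C \<union> (\<Union>v\<in>verts C. B v),
      ends = ends G, base = base (add_loops k G)\<rparr>"
  note gG' = is_graph_add_loops[OF G, of k]
  have base_B: "l \<in> loops (add_loops k G) \<and> base (add_loops k G) l = v"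
    if "v \<in> verts C" "l \<in> B v" for v l
    using B that by (auto simp: loops_at_def)
  have base_C: "Inl l \<in> loops (add_loops k G) \<and> base (add_loops k G) (Inl l) = base C l \<and>
      base C l \<in> verts C"
    if "l \<in> loops C" for l
    using subgraphD[OF C] that by (auto simp: add_loops_def)
  have loops_K: "loops_at K v = B v \<union> Inl ` loops_at C v" if "v \<in> verts C" for v
    using base_B base_C that by (auto simp: loops_at_def K_def)
  have loops_sub: "loops K \<subseteq> loops (add_loops k G)" using base_B base_C by (auto simp: K_def)
  have "finite (loops K)"
    using loops_sub gG' finite_subset unfolding is_graph_def by blast
  moreover have "ends G e \<subseteq> verts C \<and> card (ends G e) = 2" if "e \<in> edges C" for e
    using subgraphD(7)[OF C that] .
  moreover have "finite (verts C)" "finite (edges C)"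
    using C by (auto simp: subgraph_def is_graph_def)
  moreover have "base (add_loops k G) l \<in> verts C" if "l \<in> loops K" for l
    using that base_B base_C by (auto simp: K_def)
  ultimately have gK: "is_graph K" by (simp add: is_graph_def K_def)
  have "subgraph K (add_loops k G)"
    using gK loops_sub C unfolding subgraph_def by (auto simp: K_def add_loops_def)
  moreover have "card (loops_at K v - Inl ` loops C) = k" if v: "v \<in> verts C" for v
  proof -
    have "loops_at K v - Inl ` loops C = B v"
      using loops_K[OF v] B[OF v] by (auto simp: loops_at_def)
    then show ?thesis using B[OF v] by simp
  qed
  ultimately have "add_loops_copy k G C K" by (auto simp: add_loops_copy_def K_def)
  then show ?thesis using loops_K by blast
qed

section \<open>Rigidity of a component\<close>

lemma infinitesimally_rigid_iff_rigid_on: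
  assumes G: "is_graph G"
  shows "infinitesimally_rigid G p q \<longleftrightarrow> rigid_on (verts G) (adj G) (loop_span G q) p"
proof -
  have edges: "(\<forall>e \<in> edges G. \<forall>u v. ends G e = {u, v} \<longrightarrow> (p u - p v) \<bullet> (m u - m v) = 0) \<longleftrightarrow>
      (\<forall>x\<in>verts G. \<forall>y\<in>verts G. (x, y) \<in> adj G \<longrightarrow> (p x - p y) \<bullet> (m x - m y) = 0)" for m
  proof -
    have "(\<forall>e \<in> edges G. \<forall>u v. ends G e = {u, v} \<longrightarrow> (p u - p v) \<bullet> (m u - m v) = 0) \<longleftrightarrow>
        (\<forall>x y. (x, y) \<in> adj G \<longrightarrow> (p x - p y) \<bullet> (m x - m y) = 0)"
      unfolding adj_def by blast
    then show ?thesis using adj_verts[OF G] by blast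
  qed
  have span: "(\<forall>w \<in> loop_span G q x. w \<bullet> m x = 0) \<longleftrightarrow> (\<forall>l \<in> loops_at G x. q l \<bullet> m x = 0)" for m x
  proof
    assume loops: "\<forall>l \<in> loops_at G x. q l \<bullet> m x = 0"
    show "\<forall>w \<in> loop_span G q x. w \<bullet> m x = 0"
    proof
      fix w assume "w \<in> loop_span G q x"
      then have "orthogonal (m x) w"
        unfolding loop_span_def
        by (rule orthogonal_to_span)
          (use loops in \<open>auto simp: orthogonal_def inner_commute\<close>)
      then show "w \<bullet> m x = 0" by (simp add: orthogonal_def inner_commute)
    qed
  next
    assume "\<forall>w \<in> loop_span G q x. w \<bullet> m x = 0"
    then show "\<forall>l \<in> loops_at G x. q l \<bullet> m x = 0" by (simp add: loop_span_def span_base)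
  qed
  have "(\<forall>l \<in> loops G. q l \<bullet> m (base G l) = 0) \<longleftrightarrow>
      (\<forall>x\<in>verts G. \<forall>w \<in> loop_span G q x. w \<bullet> m x = 0)" for m
    unfolding span using G by (auto simp: loops_at_def is_graph_def)
  then show ?thesis
    unfolding infinitesimally_rigid_def infinitesimal_motion_def rigid_on_def edges by auto
qed

text \<open>If no constraint space is the whole space, the spaces cannot all agree along the cycle, as the
  loops of the copy span the whole space. As the cycle is connected, the space changes along some
  edge of it. In particular the cycle is not a single loop, whose copy would span the whole space at
  its one vertex.\<close>

lemma rigid_if_admissible_cycle:
  fixes q :: "'l + 'v \<times> nat \<Rightarrow> real ^ 'd" and G H C :: "('v, 'e, 'l) mgraph"
    and k :: nat
  defines "W \<equiv> loop_span (add_loops k G) q"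
  assumes dims: "\<And>x. x \<in> verts H \<Longrightarrow> dim (W x) \<ge> CARD('d) - 1"
    and H: "connected_graph H"
    and C: "subgraph C H" "is_cycle j C" "j \<noteq> 2"
    and K: "add_loops_copy k G C K" "line_admissible K q"
  shows "\<exists>p. rigid_on (verts H) (adj H) W p"
proof -
  have gH: "is_graph H" and conn: "\<And>x y. x \<in> verts H \<Longrightarrow> y \<in> verts H \<Longrightarrow> (x, y) \<in> (adj H)\<^sup>*"
    using H by (auto simp: connected_graph_iff_adj)
  interpret constrained_vertices "verts H" "adj H" W
    by (rule constrained_vertices_adj[OF gH]) (use dims in \<open>simp_all add: W_def loop_span_def\<close>)
  have cC: "connected_graph C" using C(2) by (simp add: is_cycle_def)
  show ?thesis
  proof (cases "\<exists>r \<in> verts H. W r = UNIV")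
    case True
    then show ?thesis using rigid_if_pinned_vertex conn by blast
  next
    case False
    have "\<exists>a b. (a, b) \<in> adj C \<and> W a \<noteq> W b"
    proof (rule ccontr)
      assume same: "\<not> ?thesis"
      obtain c where c: "c \<in> verts C" using cC by (auto simp: connected_graph_def)
      have W_c: "W x = W c" if "x \<in> verts C" for x
      proof -
        have "(c, x) \<in> (adj C)\<^sup>*" using cC c that by (simp add: connected_graph_iff_adj)
        then show ?thesis by (induction rule: rtrancl_induct) (use same in auto)
      qed
      have subK: "subgraph K (add_loops k G)" "verts K = verts C"
        using K(1) by (simp_all add: add_loops_copy_def)
      have "q l \<in> W c" if "l \<in> loops K" for l
      proof -
        have "base (add_loops k G) l \<in> verts C" using subgraphD(8)[OF subK(1) that] subK(2) by simp
        moreover have "l \<in> loops_at (add_loops k G) (base (add_loops k G) l)"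
          using subgraphD(4)[OF subK(1)] that by (auto simp: loops_at_def)
        then have "q l \<in> W (base (add_loops k G) l)"
          unfolding W_def loop_span_def by (intro span_base imageI)
        ultimately show ?thesis using W_c by simp
      qed
      then have "span (q ` loops K) \<subseteq> W c"
        by (intro span_minimal) (auto simp: W_def loop_span_def)
      moreover have "span (q ` loops K) = UNIV"
        using K(2) dim_eq_full[of "q ` loops K"] by (simp add: line_admissible_def)
      ultimately have "W c = UNIV" by blast
      then show False using False c subgraphD(2)[OF C(1)] by blast
    qed
    then obtain a b where ab: "(a, b) \<in> adj C" "W a \<noteq> W b" by blast
    have abH: "(a, b) \<in> adj H" using ab(1) adj_subgraph[OF C(1)] by blast
    note in_H = adj_verts[OF gH abH]
    have detour: "(b, a) \<in> (adj H - {(b, a)})\<^sup>*"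
      using cycle_detour[OF C(2,3) ab(1)] adj_subgraph[OF C(1)]
        rtrancl_mono[of "adj C - {(b, a)}" "adj H - {(b, a)}"] by blast
    show ?thesis
    proof (rule rigid_if_detour[OF abH ab(2)])
      show "W b \<noteq> UNIV" "W a \<noteq> UNIV" using False in_H by blast+
      fix x assume "x \<in> verts H"
      then have "(b, x) \<in> (adj H)\<^sup>*" using conn in_H by blast
      then show "(b, x) \<in> (adj H - {(b, a)})\<^sup>*"
      proof (induction rule: rtrancl_induct)
        case (step y z)
        show ?case
        proof (cases "(y, z) = (b, a)")
          case True
          then show ?thesis using detour by simp
        next
          case False
          then show ?thesis using step by (simp add: rtrancl_into_rtrancl)
        qed
      qed simp
    qed
  qed
qed

text \<open>A basis of \<open>d\<close> loops cannot consist of the \<open>d - 1\<close> new loops at \<open>r\<close> only. One of its loops from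
  \<open>G\<close> is the cycle; the other \<open>d - 1\<close> elements are the loops added to it.\<close>

lemma admissible_loop_if_pinned_vertex:
  fixes q :: "'l + 'v \<times> nat \<Rightarrow> real ^ 'd" and G :: "('v, 'e, 'l) mgraph"
  assumes G: "is_graph G" and r: "r \<in> verts H" "loop_span (add_loops (CARD('d) - 1) G) q r = UNIV"
    and H: "subgraph H G" "loops_at H r = loops_at G r"
  shows "\<exists>C. subgraph C H \<and> is_cycle 1 C \<and>
           (\<exists>K. add_loops_copy (CARD('d) - 1) G C K \<and> line_admissible K q)"
proof -
  define k where "k = CARD('d) - 1"
  define L where "L = loops_at (add_loops k G) r"
  have L: "span (q ` L) = UNIV" using r(2) by (simp add: L_def k_def loop_span_def)
  obtain B where B: "B \<subseteq> L" "finite B" "card B = dim (q ` L)" "span (q ` B) = UNIV"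
    using spanning_subset_of_loops[of L q] L by auto
  have cardB: "card B = CARD('d)" using B(3) L dim_eq_full[of "q ` L"] by simp
  then have Bk: "card B = Suc k" by (simp add: k_def)
  \<comment> \<open>There are only \<open>k\<close> new loops at \<open>r\<close>.\<close>
  have "\<exists>l. Inl l \<in> B"
  proof (rule ccontr)
    assume no: "\<not> ?thesis"
    have "B \<subseteq> Inr ` ({r} \<times> {..<k})"
    proof
      fix x assume x: "x \<in> B"
      then have "x \<notin> range Inl" using no by auto
      moreover have "x \<in> loops_at (add_loops k G) r" using x B(1) by (auto simp: L_def)
      ultimately show "x \<in> Inr ` ({r} \<times> {..<k})"
        by (auto simp: loops_at_add_loops split: if_splits)
    qed
    then have "card B \<le> card (Inr ` ({r} \<times> {..<k}) :: ('l + 'v \<times> nat) set)"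
      by (intro card_mono) auto
    also have "\<dots> \<le> card ({r} \<times> {..<k})" by (rule card_image_le) simp
    finally show False using Bk by simp
  qed
  then obtain l where l: "Inl l \<in> B" by blast
  have lH: "l \<in> loops H" "base H l = r"
  proof -
    have "l \<in> loops_at G r" using l B(1) by (auto simp: L_def loops_at_add_loops split: if_splits)
    then have "l \<in> loops_at H r" using H(2) by simp
    then show "l \<in> loops H" "base H l = r" by (simp_all add: loops_at_def)
  qed
  define C where "C = \<lparr>verts = {r}, edges = {}, loops = {l}, ends = ends H, base = base H\<rparr>"
  have loops_at_C: "loops_at C r = {l}" using lH by (auto simp: C_def loops_at_def)
  have gC: "is_graph C" using lH by (simp add: C_def is_graph_def)
  have subC: "subgraph C H" using gC lH r(1) by (simp add: C_def subgraph_def)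
  have cyc: "is_cycle 1 C"
    using gC loops_at_C by (simp add: is_cycle_def connected_graph_def degree_def) (simp add: C_def)
  obtain K where K: "add_loops_copy k G C K"
      and loops_K: "\<And>x. x \<in> verts C \<Longrightarrow> loops_at K x = (B - {Inl l}) \<union> Inl ` loops_at C x"
    using add_loops_copy_exists[OF G subgraph_trans[OF subC H(1)], of "\<lambda>_. B - {Inl l}" k]
      B(1,2) l Bk by (auto simp: C_def L_def)
  have "loops_at K r = B" using loops_K[of r] l loops_at_C by (auto simp: C_def)
  then have at_r: "span (q ` loops_at K r) = UNIV" using B(4) by simp
  have verts_K: "verts K = {r}" using K by (simp add: add_loops_copy_def C_def)
  have "span (q ` loops_at K r) \<subseteq> span (q ` loops K)"
    by (intro span_mono image_mono) (auto simp: loops_at_def)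
  then have "span (q ` loops K) = UNIV" using at_r by blast
  then have "line_admissible K q"
    using at_r verts_K by (simp add: line_admissible_def loop_span_def)
  then show ?thesis using subC cyc K k_def by blast
qed

text \<open>At each vertex of \<open>C\<close> the copy uses \<open>d - 1\<close> loops that form a basis of the hyperplane.\<close>

lemma admissible_copy_if_two_hyperplanes:
  fixes q :: "'l + 'v \<times> nat \<Rightarrow> real ^ 'd" and G :: "('v, 'e, 'l) mgraph"
  defines "W \<equiv> loop_span (add_loops (CARD('d) - 1) G) q"
  assumes G: "is_graph G" and C: "subgraph C G" "loops C = {}"
    and W: "\<And>x. x \<in> verts C \<Longrightarrow> dim (W x) = CARD('d) - 1"
    and uv: "u \<in> verts C" "v \<in> verts C" "W u \<noteq> W v"
  shows "\<exists>K. add_loops_copy (CARD('d) - 1) G C K \<and> line_admissible K q"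
proof -
  let ?k = "CARD('d) - 1"
  have "\<exists>B \<subseteq> loops_at (add_loops ?k G) x. card B = dim (W x) \<and> span (q ` B) = W x" for x
    using spanning_subset_of_loops[of "loops_at (add_loops ?k G) x" q]
    by (auto simp: W_def loop_span_def)
  then obtain B where B: "\<And>x. B x \<subseteq> loops_at (add_loops ?k G) x"
    "\<And>x. card (B x) = dim (W x)" "\<And>x. span (q ` B x) = W x" by metis
  obtain K where K: "add_loops_copy ?k G C K"
    and loops_K: "\<And>x. x \<in> verts C \<Longrightarrow> loops_at K x = B x \<union> Inl ` loops_at C x"
    using add_loops_copy_exists[OF G C(1), of B ?k] B(1,2) W C(2) by auto
  have loops_K: "loops_at K x = B x" if "x \<in> verts C" for x
    using loops_K[OF that] C(2) by (simp add: loops_at_def)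
  have span_K: "W x \<subseteq> span (q ` loops K)" if "x \<in> verts C" for x
  proof -
    have "W x = span (q ` loops_at K x)" using B(3) loops_K[OF that] by simp
    also have "\<dots> \<subseteq> span (q ` loops K)"
      by (intro span_mono image_mono) (auto simp: loops_at_def)
    finally show ?thesis .
  qed
  have "dim (span (q ` loops K)) = CARD('d)"
  proof (rule ccontr)
    assume "\<not> ?thesis"
    then have "dim (span (q ` loops K)) \<le> CARD('d) - 1"
      using dim_subset_UNIV[of "span (q ` loops K)"] by simp
    then have "W x = span (q ` loops K)" if "x \<in> verts C" for x
      using subspace_dim_equal[OF _ subspace_span span_K[OF that]] W[OF that]
      by (simp add: W_def loop_span_def)
    then show False using uv by simp
  qed
  moreover have "loop_span K q x = W x" if "x \<in> verts C" for x
    using B(3) loops_K[OF that] by (simp add: loop_span_def)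
  moreover have "verts K = verts C" using K by (simp add: add_loops_copy_def)
  ultimately have "line_admissible K q" using W by (simp add: line_admissible_def)
  then show ?thesis using K by blast
qed

text \<open>The normals are a function of the constraint spaces, so equal spaces have equal normals. This is
  what makes adjacent pairs with equal spaces harmless in \<open>flex_along_normals\<close>.\<close>

lemma admissible_cycle_if_rigid:
  fixes q :: "'l + 'v \<times> nat \<Rightarrow> real ^ 'd" and G H :: "('v, 'e, 'l) mgraph"
  defines "W \<equiv> loop_span (add_loops (CARD('d) - 1) G) q"
  assumes dims: "\<And>x. x \<in> verts H \<Longrightarrow> dim (W x) \<ge> CARD('d) - 1"
    and G: "is_graph G" and H: "subgraph H G" "verts H \<noteq> {}"
    and loops_H: "\<And>x. x \<in> verts H \<Longrightarrow> loops_at H x = loops_at G x"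
    and rigid: "rigid_on (verts H) (adj H) W p"
  shows "\<exists>C k. subgraph C H \<and> is_cycle k C \<and> k \<noteq> 2 \<and>
           (\<exists>K. add_loops_copy (CARD('d) - 1) G C K \<and> line_admissible K q)"
proof (cases "\<exists>r \<in> verts H. W r = UNIV")
  case True
  then obtain r where r: "r \<in> verts H" "W r = UNIV" by blast
  have "(1::nat) \<noteq> 2" by simp
  then show ?thesis
    using admissible_loop_if_pinned_vertex[OF G r(1) r(2)[unfolded W_def] H(1) loops_H[OF r(1)]]
    by blast
next
  case False
  have gH: "is_graph H" by (rule subgraphD(1)[OF H(1)])
  interpret constrained_vertices "verts H" "adj H" W
    by (rule constrained_vertices_adj[OF gH]) (use dims in \<open>simp_all add: W_def loop_span_def\<close>)
  define n where "n x = normal (W x)" for x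
  have "\<exists>u v. (u, v) \<in> adj H \<and> n u \<noteq> n v \<and> (v, u) \<in> (adj H - {(u, v), (v, u)})\<^sup>*"
  proof (rule ccontr)
    assume bridges: "\<not> ?thesis"
    obtain t where t: "\<exists>x\<in>verts H. t x \<noteq> 0"
      "\<forall>(x, y) \<in> adj H. (p x - p y) \<bullet> (t x *\<^sub>R n x - t y *\<^sub>R n y) = 0"
      using flex_along_normals[OF finite_A H(2) R_subset R_sym, of n p] bridges by blast
    have "w \<bullet> (t x *\<^sub>R n x) = 0" if "x \<in> verts H" "w \<in> W x" for x w
      using mem_W_iff[of x w] that False by (simp add: n_def)
    then have "\<forall>x\<in>verts H. t x *\<^sub>R n x = 0"
      using rigid[unfolded rigid_on_def, THEN spec, of "\<lambda>x. t x *\<^sub>R n x"] t(2) by blast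
    then show False using t(1) normal_nz by (auto simp: n_def)
  qed
  then obtain u v where uv: "(u, v) \<in> adj H" "n u \<noteq> n v"
    "(v, u) \<in> (adj H - {(u, v), (v, u)})\<^sup>*" by blast
  then have Wuv: "W u \<noteq> W v" by (auto simp: n_def)
  obtain C k where C: "subgraph C H" "is_cycle k C" "k \<noteq> 2" "loops C = {}" "u \<in> verts C" "v \<in> verts C"
    using cycle_through_non_bridge[OF gH uv(1,3)] by blast
  have "dim (W x) = CARD('d) - 1" if "x \<in> verts C" for x
  proof -
    have "x \<in> verts H" using that subgraphD(2)[OF C(1)] by blast
    then show ?thesis using dim_hyperplane_space[OF subspace_W dim_W, of x] False by simp
  qed
  then have "\<exists>K. add_loops_copy (CARD('d) - 1) G C K \<and> line_admissible K q"
    using admissible_copy_if_two_hyperplanes[OF G subgraph_trans[OF C(1) H(1)] C(4), of q u v]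
      C(5,6) Wuv unfolding W_def by blast
  then show ?thesis using C(1-3) by blast
qed

theorem theorem4p3:
  fixes G :: "('v, 'e, 'l) mgraph"
    and q :: "'l + 'v \<times> nat \<Rightarrow> real ^ 'd"
  assumes "CARD('d) \<ge> 2"
    and "is_graph G"
    and "\<forall>v \<in> verts (add_loops (CARD('d) - 1) G).
           dim (loop_span (add_loops (CARD('d) - 1) G) q v) \<ge> CARD('d) - 1"
  shows "(\<exists>p :: 'v \<Rightarrow> real ^ 'd. infinitesimally_rigid (add_loops (CARD('d) - 1) G) p q) \<longleftrightarrow>
         (\<forall>H. connected_component_of_graph H G \<longrightarrow>
            (\<exists>C k. subgraph C H \<and> is_cycle k C \<and> k \<noteq> 2 \<and>
               (\<exists>K. add_loops_copy (CARD('d) - 1) G C K \<and> line_admissible K q)))"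
proof -
  let ?G' = "add_loops (CARD('d) - 1) G"
  let ?W = "loop_span ?G' q"
  note G = assms(2)
  have G': "verts ?G' = verts G" "adj ?G' = adj G" by (simp_all add: add_loops_def adj_def)
  have "(\<exists>p. infinitesimally_rigid ?G' p q) \<longleftrightarrow> (\<exists>p. rigid_on (verts G) (adj G) ?W p)"
    unfolding infinitesimally_rigid_iff_rigid_on[OF is_graph_add_loops[OF G]] G' ..
  also have "\<dots> \<longleftrightarrow> (\<forall>v \<in> verts G. \<exists>p. rigid_on (verts (component_of G v)) (adj (component_of G v)) ?W p)"
    by (rule rigid_iff_components_rigid[OF G])
  also have "\<dots> \<longleftrightarrow> (\<forall>v \<in> verts G. \<exists>C k. subgraph C (component_of G v) \<and> is_cycle k C \<and> k \<noteq> 2 \<and>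
      (\<exists>K. add_loops_copy (CARD('d) - 1) G C K \<and> line_admissible K q))"
  proof (rule ball_cong[OF refl])
    fix v assume v: "v \<in> verts G"
    note sub = subgraph_component_of[OF G v] and conn = connected_graph_component_of[OF G v]
    have dims: "dim (?W x) \<ge> CARD('d) - 1" if "x \<in> verts (component_of G v)" for x
      using assms(3) subgraphD(2)[OF sub] that unfolding G' by blast
    have loops: "loops_at (component_of G v) x = loops_at G x" if "x \<in> verts (component_of G v)" for x
      using that by (auto simp: loops_at_def)
    have ne: "verts (component_of G v) \<noteq> {}" using conn by (simp add: connected_graph_def)
    show "(\<exists>p. rigid_on (verts (component_of G v)) (adj (component_of G v)) ?W p) \<longleftrightarrow>
      (\<exists>C k. subgraph C (component_of G v) \<and> is_cycle k C \<and> k \<noteq> 2 \<and>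
        (\<exists>K. add_loops_copy (CARD('d) - 1) G C K \<and> line_admissible K q))"
      (is "?rigid \<longleftrightarrow> ?cycle")
    proof
      assume ?rigid
      then show ?cycle by (elim exE) (rule admissible_cycle_if_rigid[OF dims G sub ne loops])
    next
      assume ?cycle
      then show ?rigid by (elim exE conjE) (rule rigid_if_admissible_cycle[OF dims conn])
    qed
  qed
  also have "\<dots> \<longleftrightarrow> (\<forall>H. connected_component_of_graph H G \<longrightarrow>
      (\<exists>C k. subgraph C H \<and> is_cycle k C \<and> k \<noteq> 2 \<and>
        (\<exists>K. add_loops_copy (CARD('d) - 1) G C K \<and> line_admissible K q)))"
    by (rule all_components_iff[OF G, symmetric])
  finally show ?thesis .
qed

end
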